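(* Let $A$ and $B$ be nonempty finite subsets of an abelian group $G$, with $|A| = |B|$ and $1 \notin B$. Let $\ell$ be a nonnegative integer. Then $\delta(A,B) > \ell$ if and only if there exists a nonempty subset $R$ of $B$ such that $A$ and $B$ can be expressed as disjoint unions $$A = S \cup Y, \qquad B = R \cup Z,$$ where $S$ is a nonempty union of cosets of $\langle R \rangle$, and $Y$ satisfies $|Y| < |R| - \ell$.
   Context: The group $G$ is written multiplicatively with identity $1$, and $\langle R \rangle$ denotes the subgroup of $G$ generated by $R$. For nonempty finite $A,B \subseteq G$ with $|A|=|B|$, a partial matching of $(A,B)$ with defect $d$ is an injective map $f : A' \to B$, where $A' \subseteq A$ and $|A \setminus A'| = d$, such that $a f(a) \notin A$ for all $a \in A'$. The empty map (with $A' = \emptyset$) is allowed. The deficiency $\delta(A,B)$ is the smallest nonnegative integer $d$ such that $(A,B)$ has a partial matching with defect $d$. *)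

theory Defs
  imports "HOL-Algebra.Coset" "HOL-Algebra.Generated_Groups"
begin

(* A partial map from A to B is given by its domain A' together with a total function f;
   only the values of f on A' are constrained. *)
definition partial_matching ::
  "('a, 'b) monoid_scheme \<Rightarrow> 'a set \<Rightarrow> 'a set \<Rightarrow> nat \<Rightarrow> 'a set \<Rightarrow> ('a \<Rightarrow> 'a) \<Rightarrow> bool"
  where "partial_matching G A B d A' f \<longleftrightarrow>
    A' \<subseteq> A \<and> card (A - A') = d \<and> f \<in> A' \<rightarrow> B \<and> inj_on f A' \<and>
    (\<forall>a\<in>A'. a \<otimes>\<^bsub>G\<^esub> f a \<notin> A)"

(* The minimum exists for every A, B: the empty map is a partial matching of defect card A. *)
definition deficiency :: "('a, 'b) monoid_scheme \<Rightarrow> 'a set \<Rightarrow> 'a set \<Rightarrow> nat"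
  where "deficiency G A B = (LEAST d. \<exists>A' f. partial_matching G A B d A' f)"

(* As the index set \<C> is arbitrary, the empty set also counts as a union of cosets. *)
definition union_of_cosets :: "('a, 'b) monoid_scheme \<Rightarrow> 'a set \<Rightarrow> 'a set \<Rightarrow> bool"
  where "union_of_cosets G H S \<longleftrightarrow> (\<exists>\<C>. \<C> \<subseteq> rcosets\<^bsub>G\<^esub> H \<and> S = \<Union>\<C>)"

end

theory Submission
  imports Defs
begin

text \<open>
  By Hall's theorem with defect, \<open>\<delta>(A,B) > l\<close> yields a nonempty \<open>X \<subseteq> A\<close> and a set
  \<open>V = {b \<in> B. X b \<subseteq> A}\<close> with \<open>|X| + |V| > |A| + l\<close>. Put \<open>W = V \<union> {1}\<close>. As long as some
  \<open>e \<in> X\<close> has \<open>e W \<not>\<subseteq> X\<close>, the Dyson transform replaces \<open>(X, W)\<close> by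
  \<open>(X \<union> e W, W \<inter> e\<inverse> X)\<close>: this preserves \<open>|X| + |W|\<close>, \<open>1 \<in> W\<close> and \<open>X W \<subseteq> A\<close> and strictly
  shrinks \<open>W\<close>. At the end \<open>X W \<subseteq> X\<close>, so \<open>X\<close> is a union of cosets of the subgroup generated
  by \<open>R = W - {1}\<close>.
  Conversely, a partial matching has to map the elements of \<open>S\<close> that it covers injectively
  into \<open>Z\<close>.
\<close>

section \<open>Hall's theorem with defect\<close>

text \<open>
  Rado's argument: if \<open>N a\<close> has two elements, one of them can be deleted without violating the
  hypothesis, as otherwise submodularity of \<open>X \<mapsto> card (\<Union>(N ` X))\<close> gives a contradiction.
\<close>

lemma Hall_defect:
  fixes N :: "'a \<Rightarrow> 'b set"
  assumes "finite A" "\<And>a. a \<in> A \<Longrightarrow> finite (N a)"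
    and "\<And>X. X \<subseteq> A \<Longrightarrow> card X \<le> card (\<Union>(N ` X)) + l"
  shows "\<exists>A' f. A' \<subseteq> A \<and> card (A - A') \<le> l \<and> inj_on f A' \<and> (\<forall>a\<in>A'. f a \<in> N a)"
  using assms(2,3)
proof (induction "\<Sum>a\<in>A. card (N a)" arbitrary: N rule: less_induct)
  case less
  note fin = less.prems(1) and hall = less.prems(2)
  show ?case
  proof (cases "\<exists>a\<in>A. \<exists>x\<in>N a. \<exists>y\<in>N a. x \<noteq> y")
    case True
    then obtain a x y where a: "a \<in> A" and xy: "x \<in> N a" "y \<in> N a" "x \<noteq> y" by blast
    \<comment> \<open>Deleting \<open>z\<close> from \<open>N a\<close> must break the hypothesis,
      as otherwise the induction hypothesis yields a matching for the smaller family, hence for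
      \<open>N\<close>. A violating set contains \<open>a\<close>, the only index where the families
      differ; \<open>X\<close> is that set without \<open>a\<close>, whence the
      \<open>+ 1\<close>.\<close>
    have *: "\<exists>X. X \<subseteq> A - {a} \<and> card (\<Union>(N ` X) \<union> (N a - {z})) + l < card X + 1"
      if z: "z \<in> N a" and no: "\<not> ?thesis" for z
    proof -
      let ?M = "N(a := N a - {z})"
      have sum_less: "(\<Sum>b\<in>A. card (?M b)) < (\<Sum>b\<in>A. card (N b))"
      proof (rule sum_strict_mono_ex1[OF assms(1)])
        show "\<forall>b\<in>A. card (?M b) \<le> card (N b)"
          using fin by (simp add: card_mono)
        show "\<exists>b\<in>A. card (?M b) < card (N b)"
          using card_Diff1_less[OF fin[OF a] z] a by (metis fun_upd_same)
      qed
      have "\<not> (\<forall>X\<subseteq>A. card X \<le> card (\<Union>(?M ` X)) + l)"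
      proof
        assume "\<forall>X\<subseteq>A. card X \<le> card (\<Union>(?M ` X)) + l"
        then obtain A' f where "A' \<subseteq> A" "card (A - A') \<le> l" "inj_on f A'" "\<forall>b\<in>A'. f b \<in> ?M b"
          using less.hyps[OF sum_less] fin by (metis finite_Diff fun_upd_apply)
        moreover from this have "\<forall>b\<in>A'. f b \<in> N b"
          by (metis DiffD1 fun_upd_apply)
        ultimately show False using no by blast
      qed
      then obtain X where X: "X \<subseteq> A" "card (\<Union>(?M ` X)) + l < card X"
        by (meson not_less)
      have "a \<in> X"
      proof (rule ccontr)
        assume "a \<notin> X"
        then have "?M ` X = N ` X" by auto
        then show False using hall[OF X(1)] X(2) by simp
      qed
      moreover from this have "\<Union>(?M ` X) = \<Union>(N ` (X - {a})) \<union> (N a - {z})"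
        by (auto split: if_splits)
      moreover have "card X = card (X - {a}) + 1"
        using \<open>a \<in> X\<close> finite_subset[OF X(1) assms(1)]
        by (metis Suc_eq_plus1 card_Suc_Diff1)
      ultimately show ?thesis
        using X by (intro exI[of _ "X - {a}"]) auto
    qed
    show ?thesis
    proof (rule ccontr)
      assume no: "\<not> ?thesis"
      from *[OF xy(1) no] obtain X where
        X: "X \<subseteq> A - {a}" "card (\<Union>(N ` X) \<union> (N a - {x})) + l < card X + 1" by blast
      from *[OF xy(2) no] obtain Y where
        Y: "Y \<subseteq> A - {a}" "card (\<Union>(N ` Y) \<union> (N a - {y})) + l < card Y + 1" by blast
      let ?U = "\<Union>(N ` X) \<union> (N a - {x})" and ?V = "\<Union>(N ` Y) \<union> (N a - {y})"
      have finXY: "finite X" "finite Y"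
        using X(1) Y(1) assms(1) by (meson finite_Diff finite_subset)+
      have finUV: "finite ?U" "finite ?V"
        using X(1) Y(1) finXY fin a by auto
      \<comment> \<open>As \<open>x \<noteq> y\<close>, the two punctured copies of
        \<open>N a\<close> together give back \<open>N a\<close>. The hypothesis for
        \<open>insert a (X \<union> Y)\<close> and for \<open>X \<inter> Y\<close> then yields
        \<open>card X + card Y + 1 \<le> card ?U + card ?V + 2 * l\<close>, whereas the choice of
        \<open>X\<close> and \<open>Y\<close> bounds the right side by
        \<open>card X + card Y\<close>.\<close>
      have UV: "?U \<union> ?V = \<Union>(N ` insert a (X \<union> Y))"
        using xy by auto
      have "insert a (X \<union> Y) \<subseteq> A" using X(1) Y(1) a by blast
      from hall[OF this] have 1: "card (insert a (X \<union> Y)) \<le> card (?U \<union> ?V) + l"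
        unfolding UV .
      have "card (\<Union>(N ` (X \<inter> Y))) \<le> card (?U \<inter> ?V)"
        using finUV by (intro card_mono) auto
      then have 2: "card (X \<inter> Y) \<le> card (?U \<inter> ?V) + l"
        using hall[of "X \<inter> Y"] X(1) by force
      have 3: "card (insert a (X \<union> Y)) = card (X \<union> Y) + 1"
        using X(1) Y(1) finXY by (subst card_insert_disjoint) auto
      show False
        using 1 2 3 X(2) Y(2) card_Un_Int[OF finXY] card_Un_Int[OF finUV] by linarith
    qed
  next
    case False
    \<comment> \<open>Every \<open>N a\<close> now has at most one element. Picking one index
      \<open>g b\<close> for each \<open>b\<close> in \<open>?U\<close> gives as many indices as
      \<open>?U\<close> has elements, so at most \<open>l\<close> are missed. The description in
      \<open>f\<close> is meaningful on these indices, where \<open>N a\<close> is a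
      singleton.\<close>
    let ?U = "\<Union>(N ` A)"
    define g where "g b = (SOME a. a \<in> A \<and> b \<in> N a)" for b
    have g: "g b \<in> A" "b \<in> N (g b)" if "b \<in> ?U" for b
      using someI_ex[of "\<lambda>a. a \<in> A \<and> b \<in> N a"] that unfolding g_def by auto
    define f where "f a = (THE b. b \<in> N a)" for a
    have f: "f (g b) = b" if "b \<in> ?U" for b
      using g[OF that] False unfolding f_def by (intro the_equality) auto
    have sub: "g ` ?U \<subseteq> A" using g by auto
    have "inj_on g ?U" using f by (metis inj_onI)
    then have "card (g ` ?U) = card ?U" by (rule card_image)
    then have "card (A - g ` ?U) \<le> l"
      using hall[of A] sub assms(1) by (simp add: card_Diff_subset finite_subset)
    moreover have "inj_on f (g ` ?U)"
      using f by (auto simp: inj_on_def)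
    moreover have "\<forall>a\<in>g ` ?U. f a \<in> N a"
      using f g by auto
    ultimately show ?thesis using sub by blast
  qed
qed

lemma deficiency_le_iff:
  assumes "finite A"
  shows "deficiency G A B \<le> l \<longleftrightarrow> (\<exists>d\<le>l. \<exists>A' f. partial_matching G A B d A' f)"
proof
  have "partial_matching G A B (card A) {} f" for f
    by (simp add: partial_matching_def)
  then have "\<exists>A' f. partial_matching G A B (deficiency G A B) A' f"
    unfolding deficiency_def by (intro LeastI) blast
  then show "deficiency G A B \<le> l \<Longrightarrow> \<exists>d\<le>l. \<exists>A' f. partial_matching G A B d A' f"
    by blast
next
  assume "\<exists>d\<le>l. \<exists>A' f. partial_matching G A B d A' f"
  then obtain d where "d \<le> l" "\<exists>A' f. partial_matching G A B d A' f" by blast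
  then show "deficiency G A B \<le> l"
    unfolding deficiency_def by (rule order_trans[OF Least_le, rotated])
qed

section \<open>Dyson transform\<close>

text \<open>Each transform loses some \<open>w0\<close> from \<open>W\<close>, so induction on
  \<open>card W\<close> applies; the process stops at the latest at \<open>W = {\<one>}\<close>,
  under which every \<open>X\<close> is stable.\<close>

lemma (in comm_group) Dyson_transform_stable:
  assumes "finite A"
    and "finite W" "W \<subseteq> carrier G" "\<one> \<in> W"
    and "X \<noteq> {}" "X \<subseteq> carrier G" "\<And>x w. x \<in> X \<Longrightarrow> w \<in> W \<Longrightarrow> x \<otimes> w \<in> A"
  shows "\<exists>X' W'. X' \<noteq> {} \<and> X' \<subseteq> A \<and> W' \<subseteq> W \<and> \<one> \<in> W' \<and>
    card X' + card W' = card X + card W \<and> (\<forall>x\<in>X'. \<forall>w\<in>W'. x \<otimes> w \<in> X')"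
  using assms(2-)
proof (induction "card W" arbitrary: X W rule: less_induct)
  case less
  note W = less.prems(1-3) and X = less.prems(4,5) and XW = less.prems(6)
  have XA: "X \<subseteq> A"
    using XW[OF _ W(3)] X(2) by (metis r_one subset_iff)
  show ?case
  proof (cases "\<forall>x\<in>X. \<forall>w\<in>W. x \<otimes> w \<in> X")
    case True
    then show ?thesis using W X XA by blast
  next
    case False
    then obtain e w0 where e: "e \<in> X" and w0: "w0 \<in> W" "e \<otimes> w0 \<notin> X" by blast
    have ec: "e \<in> carrier G" using e X by blast
    define eW where "eW = (\<otimes>) e ` W"
    \<comment> \<open>This is the intersection of \<open>W\<close> with the translate of
      \<open>X\<close> by the inverse of \<open>e\<close>; it keeps \<open>\<one>\<close> because
      \<open>e \<in> X\<close>.\<close>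
    define W' where "W' = {w \<in> W. e \<otimes> w \<in> X}"
    have inj: "inj_on ((\<otimes>) e) (carrier G)"
      using ec by (auto simp: inj_on_def)
    have "W' \<subset> W" using w0 by (auto simp: W'_def)
    then have less_card: "card W' < card W" using W(1) psubset_card_mono by blast
    have "eW \<inter> X = (\<otimes>) e ` W'" by (auto simp: W'_def eW_def)
    \<comment> \<open>Translation by \<open>e\<close> is injective, so inclusion-exclusion for
      \<open>X\<close> and \<open>eW\<close> shows that the sum of the cardinalities is
      preserved.\<close>
    then have "card (X \<inter> eW) = card W'"
      using inj W(2) \<open>W' \<subset> W\<close> by (metis Int_commute card_image inj_on_subset psubset_imp_subset)
    moreover have "card eW = card W"
      using inj W(2) unfolding eW_def by (metis card_image inj_on_subset)
    moreover have "finite X" "finite eW"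
      using XA assms(1) W(1) finite_subset by (auto simp: eW_def)
    ultimately have cards: "card (X \<union> eW) + card W' = card X + card W"
      using card_Un_Int[of X eW] by simp
    have "x \<otimes> w \<in> A" if x: "x \<in> X \<union> eW" and w: "w \<in> W'" for x w
    proof (cases "x \<in> X")
      case True
      then show ?thesis using XW w by (simp add: W'_def)
    next
      case False
      then obtain v where v: "v \<in> W" "x = e \<otimes> v" using x by (auto simp: eW_def)
      \<comment> \<open>Commutativity moves \<open>w\<close> next to \<open>e\<close>:
        \<open>e \<otimes> w\<close> lies in \<open>X\<close> by the choice of \<open>W'\<close>,
        and \<open>v\<close> is in the old \<open>W\<close>.\<close>
      then have "x \<otimes> w = (e \<otimes> w) \<otimes> v"
        using w W(2) ec by (simp add: W'_def m_ac subset_iff)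
      then show ?thesis using w v XW by (simp add: W'_def)
    qed
    moreover have "finite W'" "W' \<subseteq> carrier G" "\<one> \<in> W'" "X \<union> eW \<noteq> {}" "X \<union> eW \<subseteq> carrier G"
      using W X e ec by (auto simp: W'_def eW_def)
    ultimately have "\<exists>X'' W''. X'' \<noteq> {} \<and> X'' \<subseteq> A \<and> W'' \<subseteq> W' \<and> \<one> \<in> W'' \<and>
        card X'' + card W'' = card (X \<union> eW) + card W' \<and> (\<forall>x\<in>X''. \<forall>w\<in>W''. x \<otimes> w \<in> X'')"
      by (intro less.hyps[OF less_card]) auto
    then show ?thesis
      unfolding cards using \<open>W' \<subset> W\<close> by (meson order_trans psubset_imp_subset)
  qed
qed

section \<open>Stable sets and unions of cosets\<close>

text \<open>Translation by \<open>r\<close> maps the finite set \<open>S\<close> injectively into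
  itself, hence onto itself, so the inverse of \<open>r\<close> preserves \<open>S\<close> as well.
  Thus the whole generated subgroup does, and \<open>S\<close> is the union of the cosets of its
  elements.\<close>

lemma (in comm_group) union_of_cosets_if_stable:
  assumes "finite S" "S \<subseteq> carrier G" "R \<subseteq> carrier G"
    and stable: "\<And>s r. s \<in> S \<Longrightarrow> r \<in> R \<Longrightarrow> s \<otimes> r \<in> S"
  shows "union_of_cosets G (generate G R) S"
proof -
  let ?H = "generate G R"
  have H: "subgroup ?H G" using assms(3) by (rule generate_is_subgroup)
  \<comment> \<open>The action is written on the left because the right coset \<open>?H #> s\<close>
    consists of the products \<open>h \<otimes> s\<close>.\<close>
  have act: "h \<otimes> s \<in> S" if "h \<in> ?H" "s \<in> S" for h s
    using that
  proof (induction arbitrary: s rule: generate.induct)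
    case one
    then show ?case using assms(2) by auto
  next
    case (incl r)
    then show ?case using stable assms(2,3) m_comm by (metis subset_iff)
  next
    case (inv r)
    have r: "r \<in> carrier G" using inv assms(3) by blast
    have "(\<otimes>) r ` S \<subseteq> S"
      using stable inv(1) r assms(2) m_comm by (metis image_subsetI subset_iff)
    moreover have "inj_on ((\<otimes>) r) S"
      using r assms(2) by (auto simp: inj_on_def subset_iff)
    ultimately have "(\<otimes>) r ` S = S" using assms(1) by (simp add: endo_inj_surj)
    then obtain t where "t \<in> S" "s = r \<otimes> t" using inv(2) by blast
    then show ?case using r assms(2) by (auto simp: m_assoc[symmetric])
  next
    case (eng h1 h2)
    then have "h1 \<in> carrier G" "h2 \<in> carrier G"
      using H subgroup.subset by blast+
    then show ?case using eng assms(2) by (simp add: m_assoc subset_iff)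
  qed
  have "S = \<Union>((\<lambda>s. ?H #> s) ` S)"
  proof
    show "S \<subseteq> \<Union>((\<lambda>s. ?H #> s) ` S)"
      using rcos_self[OF _ H] assms(2) by blast
    show "\<Union>((\<lambda>s. ?H #> s) ` S) \<subseteq> S"
      using act by (auto simp: r_coset_def)
  qed
  moreover have "(\<lambda>s. ?H #> s) ` S \<subseteq> rcosets ?H"
    using assms(2) by (auto simp: RCOSETS_def)
  ultimately show ?thesis unfolding union_of_cosets_def by metis
qed

lemma (in comm_group) stable_if_union_of_cosets:
  assumes "union_of_cosets G (generate G R) S" "R \<subseteq> carrier G" "s \<in> S" "r \<in> R"
  shows "s \<otimes> r \<in> S"
proof -
  let ?H = "generate G R"
  have H: "subgroup ?H G" using assms(2) by (rule generate_is_subgroup)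
  obtain C where C: "C \<in> rcosets ?H" "s \<in> C" "C \<subseteq> S"
    using assms(1,3) unfolding union_of_cosets_def by blast
  then obtain g where g: "g \<in> carrier G" "C = ?H #> g"
    unfolding RCOSETS_def by blast
  with C(2) obtain h where h: "h \<in> ?H" "s = h \<otimes> g"
    unfolding r_coset_def by blast
  have "r \<in> ?H" using assms(4) by (rule generate.incl)
  then have "h \<otimes> r \<in> ?H" using h(1) by (simp add: generate.eng)
  moreover have "s \<otimes> r = (h \<otimes> r) \<otimes> g"
    using h g assms(2,4) subgroup.mem_carrier[OF H h(1)] by (auto simp: m_ac)
  ultimately show ?thesis using C(3) g unfolding r_coset_def by blast
qed

section \<open>Lower bound for the defect\<close>

text \<open>At most \<open>d\<close> elements of \<open>S\<close> are uncovered. For a covered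
  \<open>a\<close> in \<open>S\<close> the value \<open>f a\<close> avoids \<open>R\<close>, since
  \<open>a \<otimes> r\<close> stays in \<open>S \<subseteq> A\<close> for \<open>r \<in> R\<close>;
  so the covered ones inject into \<open>B - R\<close>.\<close>

lemma (in comm_group) partial_matching_defect_ge:
  assumes A: "A = S \<union> Y" "S \<inter> Y = {}" "finite A"
    and B: "R \<subseteq> B" "finite B" "B \<subseteq> carrier G"
    and S: "union_of_cosets G (generate G R) S"
    and m: "partial_matching G A B d A' f"
  shows "card S + card R \<le> d + card B"
proof -
  have m': "A' \<subseteq> A" "card (A - A') = d" "f \<in> A' \<rightarrow> B" "inj_on f A'"
      "\<And>a. a \<in> A' \<Longrightarrow> a \<otimes> f a \<notin> A"
    using m by (auto simp: partial_matching_def)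
  have "f ` (S \<inter> A') \<subseteq> B - R"
    using m'(3,5) stable_if_union_of_cosets[OF S] A(1) B(1,3) by blast
  moreover have "inj_on f (S \<inter> A')" using m'(4) by (rule inj_on_subset) simp
  ultimately have "card (S \<inter> A') \<le> card (B - R)"
    using B(2) by (meson card_inj_on_le finite_Diff)
  moreover have "card (B - R) + card R = card B"
    using B(1,2) by (metis card_Diff_subset card_mono finite_subset le_add_diff_inverse2)
  moreover have "card S = card (S \<inter> A') + card (S - A')"
    using A by (subst card_Un_disjoint[symmetric]) (auto intro: arg_cong[where f = card])
  moreover have "card (S - A') \<le> d"
    using A m'(2) by (metis Diff_mono Un_upper1 card_mono finite_Diff order_refl)
  ultimately show ?thesis by linarith
qed

section \<open>Large deficiency and coset decompositions\<close>

theorem theorem4p1: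
  fixes G (structure) and A B :: "'a set" and l :: nat
  assumes "comm_group G"
    and "A \<subseteq> carrier G" and "finite A" and "A \<noteq> {}"
    and "B \<subseteq> carrier G" and "finite B" and "B \<noteq> {}"
    and "card A = card B"
    and "\<one> \<notin> B"
  shows "deficiency G A B > l \<longleftrightarrow>
    (\<exists>R S Y Z. R \<noteq> {} \<and> R \<subseteq> B \<and>
       A = S \<union> Y \<and> S \<inter> Y = {} \<and>
       B = R \<union> Z \<and> R \<inter> Z = {} \<and>
       S \<noteq> {} \<and> union_of_cosets G (generate G R) S \<and>
       int (card Y) < int (card R) - int l)" (is "_ \<longleftrightarrow> ?rhs")
proof -
  interpret comm_group G by fact
  note A = assms(2-4) and B = assms(5-7) and cardAB = assms(8) and one = assms(9)
  show ?thesis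
  proof
    assume large: "deficiency G A B > l"
    \<comment> \<open>The admissible partners of \<open>a\<close>: a choice from these sets,
      injective on its domain, is a partial matching.\<close>
    define N where "N a = {b \<in> B. a \<otimes> b \<notin> A}" for a
    have finN: "finite (N a)" for a using B(2) by (simp add: N_def)
    have "\<not> (\<forall>X\<subseteq>A. card X \<le> card (\<Union>(N ` X)) + l)"
    proof
      assume "\<forall>X\<subseteq>A. card X \<le> card (\<Union>(N ` X)) + l"
      then obtain A' f where "A' \<subseteq> A" "card (A - A') \<le> l" "inj_on f A'" "\<forall>a\<in>A'. f a \<in> N a"
        using Hall_defect[OF A(2), of N l] finN by blast
      then have "partial_matching G A B (card (A - A')) A' f"
        by (auto simp: partial_matching_def N_def)
      with \<open>card (A - A') \<le> l\<close> large show False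
        using deficiency_le_iff[OF A(2)] by (meson not_less)
    qed
    then obtain X where X: "X \<subseteq> A" "card (\<Union>(N ` X)) + l < card X"
      by (meson not_less)
    define V where "V = B - \<Union>(N ` X)"
    have "card V = card B - card (\<Union>(N ` X))" "card (\<Union>(N ` X)) \<le> card B"
      using B(2) unfolding V_def
      by (auto intro!: card_Diff_subset card_mono finite_subset[OF _ B(2)] simp: N_def)
    with X(2) cardAB have XV: "card A + l < card X + card V" by linarith
    have "X \<noteq> {}" using X(2) by auto
    moreover have "finite (insert \<one> V)" "insert \<one> V \<subseteq> carrier G" "X \<subseteq> carrier G"
      using A B X(1) by (auto simp: V_def)
    moreover have "x \<otimes> w \<in> A" if "x \<in> X" "w \<in> insert \<one> V" for x w
    proof (cases "w = \<one>")
      case True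
      then show ?thesis using that(1) X(1) A(1) by (metis r_one subsetD)
    next
      case False
      then show ?thesis using that by (simp add: V_def N_def)
    qed
    ultimately obtain S W where SW: "S \<noteq> {}" "S \<subseteq> A" "W \<subseteq> insert \<one> V" "\<one> \<in> W"
        "card S + card W = card X + card (insert \<one> V)" "\<forall>s\<in>S. \<forall>w\<in>W. s \<otimes> w \<in> S"
      using Dyson_transform_stable[OF A(2), of "insert \<one> V" X] by auto
    define R where "R = W - {\<one>}"
    have V: "finite V" "\<one> \<notin> V" "V \<subseteq> B" using B(2) one by (auto simp: V_def)
    have RB: "R \<subseteq> B" using SW(3) V(3) by (auto simp: R_def)
    \<comment> \<open>The \<open>\<one>\<close> removed from \<open>W\<close> cancels the one added
      to \<open>V\<close>, which was new because \<open>\<one> \<notin> B\<close>.\<close>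
    have "card W = card R + 1"
      using SW(3,4) V(1) finite_subset[of W "insert \<one> V"]
      by (metis R_def Suc_eq_plus1 card_Suc_Diff1 finite_insert)
    with SW(5) V XV have SR: "card A + l < card S + card R" by simp
    have "card (A - S) + card S = card A"
      using SW(2) A(2) by (metis card_Diff_subset card_mono finite_subset le_add_diff_inverse2)
    with SR have Y: "int (card (A - S)) < int (card R) - int l" by linarith
    then have "R \<noteq> {}" by auto
    moreover have "union_of_cosets G (generate G R) S"
      using SW(2,6) A(1) B(1) RB finite_subset[OF SW(2) A(2)]
      by (intro union_of_cosets_if_stable) (auto simp: R_def)
    moreover have "A = S \<union> (A - S)" "B = R \<union> (B - R)" "S \<inter> (A - S) = {}" "R \<inter> (B - R) = {}"
      using SW(2) RB by blast+
    ultimately show ?rhs using RB SW(1) Y by metis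
  next
    assume ?rhs
    then obtain R S Y where R: "R \<subseteq> B" and Y: "A = S \<union> Y" "S \<inter> Y = {}"
      and S: "union_of_cosets G (generate G R) S"
      and c: "int (card Y) < int (card R) - int l" by blast
    have "card A = card S + card Y"
      using Y A(2) by (simp add: card_Un_disjoint)
    \<comment> \<open>Since \<open>card B = card S + card Y\<close>, the lower bound becomes
      \<open>card R \<le> d + card Y\<close>, while \<open>card Y + l < card R\<close>.\<close>
    then have "l < d" if "partial_matching G A B d A' f" for d A' f
      using partial_matching_defect_ge[OF Y A(2) R B(2,1) S that] c cardAB by linarith
    then show "deficiency G A B > l"
      using deficiency_le_iff[OF A(2)] by (meson not_less)
  qed
qed

end
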